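(* Let $p_v$ and $q_v$ ($v\in[0,1]$) be weighted means, each being one of the three standard weighted means $\nabla_v$, $\sharp_v$, $!_v$, and let $p:=p_{1/2}$, $q:=q_{1/2}$. Then there exists one and only one weighted mean $M_v$ ($v\in[0,1]$) such that, with $M:=M_{1/2}$, $$M_v(a,b)=q_v\Big(M\big(p_v(a,b),a\big),\,M\big(p_v(a,b),b\big)\Big)\qquad\text{for all } a,b>0,\ v\in[0,1].$$ Further, $M=M_{1/2}$ is the unique $(q,p)$-stabilizable mean.
   Context: For $a,b>0$ and $v\in[0,1]$: $a\nabla_v b=(1-v)a+vb$, $a\sharp_v b=a^{1-v}b^v$, $a!_v b=\big((1-v)a^{-1}+vb^{-1}\big)^{-1}$. A (binary) mean is a map $m:(0,\infty)^2\to(0,\infty)$ with $\min(a,b)\le m(a,b)\le\max(a,b)$ for all $a,b>0$. It is symmetric if $m(a,b)=m(b,a)$. The means $\min$ and $\max$ are called trivial. A weighted mean is a family $(m_v)_{v\in[0,1]}$ of binary maps such that: (i) $m_v$ is a mean for every $v\in[0,1]$; (ii) $m_{1/2}$ is a symmetric mean; (iii) $m_v(a,b)=m_{1-v}(b,a)$ for all $a,b>0$, $v\in[0,1]$. For symmetric means $m_1,m_2,m_3$, the resultant mean-map is $$\mathcal R(m_1,m_2,m_3)(a,b)=m_1\Big(m_2\big(a,m_3(a,b)\big),\,m_2\big(m_3(a,b),b\big)\Big),\quad a,b>0.$$ A symmetric mean $m$ is stable if $\mathcal R(m,m,m)=m$. A symmetric mean $m$ is stabilizable if there are two nontrivial stable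 means $m_1,m_2$ such that $\mathcal R(m_1,m,m_2)=m$; one then says that $m$ is $(m_1,m_2)$-stabilizable. *)

theory Defs
  imports Complex_Main
begin

(* Binary maps on the positive reals are total functions on real, of which only the values at
   positive arguments matter.  Equality of such maps is therefore agreement on (0,oo) x (0,oo). *)

definition eq_pos :: "(real \<Rightarrow> real \<Rightarrow> real) \<Rightarrow> (real \<Rightarrow> real \<Rightarrow> real) \<Rightarrow> bool" where
  "eq_pos m m' \<longleftrightarrow> (\<forall>a>0. \<forall>b>0. m a b = m' a b)"

definition wt_arith :: "real \<Rightarrow> real \<Rightarrow> real \<Rightarrow> real" where
  "wt_arith v a b = (1 - v) * a + v * b"

definition wt_geom :: "real \<Rightarrow> real \<Rightarrow> real \<Rightarrow> real" where
  "wt_geom v a b = a powr (1 - v) * b powr v"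

definition wt_harm :: "real \<Rightarrow> real \<Rightarrow> real \<Rightarrow> real" where
  "wt_harm v a b = inverse ((1 - v) * inverse a + v * inverse b)"

definition is_mean :: "(real \<Rightarrow> real \<Rightarrow> real) \<Rightarrow> bool" where
  "is_mean m \<longleftrightarrow> (\<forall>a>0. \<forall>b>0. 0 < m a b \<and> min a b \<le> m a b \<and> m a b \<le> max a b)"

definition symmetric_mean :: "(real \<Rightarrow> real \<Rightarrow> real) \<Rightarrow> bool" where
  "symmetric_mean m \<longleftrightarrow> is_mean m \<and> (\<forall>a>0. \<forall>b>0. m a b = m b a)"

definition nontrivial_mean :: "(real \<Rightarrow> real \<Rightarrow> real) \<Rightarrow> bool" where
  "nontrivial_mean m \<longleftrightarrow> is_mean m \<and> \<not> eq_pos m min \<and> \<not> eq_pos m max"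

definition weighted_mean :: "(real \<Rightarrow> real \<Rightarrow> real \<Rightarrow> real) \<Rightarrow> bool" where
  "weighted_mean M \<longleftrightarrow>
     (\<forall>v\<in>{0..1}. is_mean (M v)) \<and>
     symmetric_mean (M (1/2)) \<and>
     (\<forall>v\<in>{0..1}. \<forall>a>0. \<forall>b>0. M v a b = M (1 - v) b a)"

definition resultant ::
  "(real \<Rightarrow> real \<Rightarrow> real) \<Rightarrow> (real \<Rightarrow> real \<Rightarrow> real) \<Rightarrow> (real \<Rightarrow> real \<Rightarrow> real) \<Rightarrow> real \<Rightarrow> real \<Rightarrow> real" where
  "resultant m1 m2 m3 a b = m1 (m2 a (m3 a b)) (m2 (m3 a b) b)"

definition stable_mean :: "(real \<Rightarrow> real \<Rightarrow> real) \<Rightarrow> bool" where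
  "stable_mean m \<longleftrightarrow> symmetric_mean m \<and> eq_pos (resultant m m m) m"

definition stabilizable_by ::
  "(real \<Rightarrow> real \<Rightarrow> real) \<Rightarrow> (real \<Rightarrow> real \<Rightarrow> real) \<Rightarrow> (real \<Rightarrow> real \<Rightarrow> real) \<Rightarrow> bool" where
  "stabilizable_by m1 m2 m \<longleftrightarrow>
     symmetric_mean m \<and>
     stable_mean m1 \<and> nontrivial_mean m1 \<and>
     stable_mean m2 \<and> nontrivial_mean m2 \<and>
     eq_pos (resultant m1 m m2) m"

definition solves_mean_eq ::
  "(real \<Rightarrow> real \<Rightarrow> real \<Rightarrow> real) \<Rightarrow> (real \<Rightarrow> real \<Rightarrow> real \<Rightarrow> real) \<Rightarrow>
   (real \<Rightarrow> real \<Rightarrow> real \<Rightarrow> real) \<Rightarrow> bool" where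
  "solves_mean_eq p q M \<longleftrightarrow>
     (\<forall>v\<in>{0..1}. \<forall>a>0. \<forall>b>0.
        M v a b = q v (M (1/2) (p v a b) a) (M (1/2) (p v a b) b))"

end

theory Submission
  imports Defs
begin

text \<open>
  Let \<open>\<psi>\<close> be the generator of \<open>q\<close> (identity, logarithm or inversion), so that \<open>q\<close> at weight \<open>1/2\<close>
  is the arithmetic mean in the coordinate \<open>\<psi>\<close>. At \<open>v = 1/2\<close> the equation says that
  \<open>f = \<psi> \<circ> M\<close> is a fixed point of the refinement operator
  \<open>f \<mapsto> ((a, b) \<mapsto> (f (p a b) a + f (p a b) b) / 2)\<close>. As \<open>\<psi>\<close> is monotone and \<open>p a b\<close> lies between
  \<open>a\<close> and \<open>b\<close>, the increments of \<open>\<psi>\<close> over the two halves add up to \<open>\<bar>\<psi> a - \<psi> b\<bar>\<close>; hence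
  refinement halves the norm \<open>sup \<bar>f a b\<bar> / \<bar>\<psi> a - \<psi> b\<bar>\<close>, and the fixed point exists and is unique.
  The other \<open>M v\<close> are then given explicitly by the equation, and stabilizability by \<open>(q, p)\<close> is the
  equation at \<open>v = 1/2\<close> again.
\<close>

definition refine :: "(real \<Rightarrow> real \<Rightarrow> real) \<Rightarrow> (real \<Rightarrow> real \<Rightarrow> real) \<Rightarrow> real \<Rightarrow> real \<Rightarrow> real" where
  "refine p f a b = (f (p a b) a + f (p a b) b) / 2"

lemma is_meanD:
  assumes "is_mean m" "0 < a" "0 < b"
  shows "0 < m a b" "m a b \<in> {min a b..max a b}"
  using assms by (auto simp: is_mean_def)

lemma convex_combination_mem_interval:
  fixes x y :: real
  assumes "x \<in> {c..d}" "y \<in> {c..d}" "v \<in> {0..1}"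
  shows "(1 - v) * x + v * y \<in> {c..d}"
  \<comment> \<open>The lower bound is the convex upper bound applied to the negated values.\<close>
  using assms convex_bound_le[of x d y "1 - v" v] convex_bound_le[of "-x" "-c" "-y" "1 - v" v]
  by auto

text \<open>Together with injectivity, \<open>image\<close> packs monotonicity and continuity of the
  generator into one condition; its \<open>min\<close>/\<open>max\<close> form covers the decreasing
  generator \<open>inverse\<close> as well as the increasing ones.\<close>

locale quasi_arithmetic =
  fixes q :: "real \<Rightarrow> real \<Rightarrow> real \<Rightarrow> real" and \<psi> \<chi> :: "real \<Rightarrow> real"
  assumes eq: "0 < a \<Longrightarrow> 0 < b \<Longrightarrow> q v a b = \<chi> ((1 - v) * \<psi> a + v * \<psi> b)"
    and inverse: "0 < a \<Longrightarrow> \<chi> (\<psi> a) = a"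
    and image: "0 < a \<Longrightarrow> 0 < b \<Longrightarrow>
      \<psi> ` {min a b..max a b} = {min (\<psi> a) (\<psi> b)..max (\<psi> a) (\<psi> b)}"
begin

lemma generator_mem:
  assumes "0 < a" "0 < b" "c \<in> {min a b..max a b}"
  shows "\<psi> c \<in> {min (\<psi> a) (\<psi> b)..max (\<psi> a) (\<psi> b)}"
  using image[OF assms(1,2)] assms(3) by blast

text \<open>\<open>image\<close> supplies a preimage of \<open>t\<close> between \<open>a\<close>
  and \<open>b\<close>, which the left inverse law identifies as \<open>\<chi> t\<close>. So
  \<open>\<chi>\<close> is also a right inverse wherever one is needed.\<close>

lemma inverse_mem:
  assumes "0 < a" "0 < b" "t \<in> {min (\<psi> a) (\<psi> b)..max (\<psi> a) (\<psi> b)}"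
  shows "\<chi> t \<in> {min a b..max a b}" "\<psi> (\<chi> t) = t" "0 < \<chi> t"
proof -
  obtain c where c: "c \<in> {min a b..max a b}" "t = \<psi> c"
    using image[OF assms(1,2)] assms(3) by blast
  with assms have "0 < c" by auto
  with c inverse show "\<chi> t \<in> {min a b..max a b}" "\<psi> (\<chi> t) = t" "0 < \<chi> t" by auto
qed

lemma generator_inj:
  assumes "0 < a" "0 < b" "\<psi> a = \<psi> b"
  shows "a = b"
  using assms inverse by metis

lemma increments_add:
  assumes "0 < a" "0 < b" "c \<in> {min a b..max a b}"
  shows "\<bar>\<psi> c - \<psi> a\<bar> + \<bar>\<psi> c - \<psi> b\<bar> = \<bar>\<psi> a - \<psi> b\<bar>"
  using generator_mem[OF assms] by (auto simp: min_def max_def split: if_splits)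

lemma weight_mem:
  assumes "v \<in> {0..1}"
  shows "(1 - v) * \<psi> a + v * \<psi> b \<in> {min (\<psi> a) (\<psi> b)..max (\<psi> a) (\<psi> b)}"
  using assms by (intro convex_combination_mem_interval) auto

lemma generator_eq:
  assumes "0 < a" "0 < b" "v \<in> {0..1}"
  shows "\<psi> (q v a b) = (1 - v) * \<psi> a + v * \<psi> b"
  using assms eq inverse_mem(2)[OF _ _ weight_mem] by simp

section \<open>Quasi-arithmetic weighted means and stability at weight 1/2\<close>

lemma is_mean: "v \<in> {0..1} \<Longrightarrow> is_mean (q v)"
  unfolding is_mean_def using eq inverse_mem(1,3)[OF _ _ weight_mem, of _ _ v] by auto

lemma flip: "0 < a \<Longrightarrow> 0 < b \<Longrightarrow> q (1 - v) b a = q v a b"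
  using eq by (simp add: add.commute)

lemma symmetric: "symmetric_mean (q (1/2))"
  unfolding symmetric_mean_def using is_mean[of "1/2"] flip[of _ _ "1/2"] by auto

lemma half_eq: "0 < a \<Longrightarrow> 0 < b \<Longrightarrow> \<psi> (q (1/2) a b) = (\<psi> a + \<psi> b) / 2"
  using generator_eq[of a b "1/2"] by simp

text \<open>In the coordinate \<open>\<psi>\<close> both sides are the midpoint: averaging (3x +
  y)/4 and (x + 3y)/4 gives (x + y)/2. Injectivity of \<open>\<psi>\<close> transfers this
  back.\<close>

lemma stable: "stable_mean (q (1/2))"
proof -
  have "resultant (q (1/2)) (q (1/2)) (q (1/2)) a b = q (1/2) a b" if "0 < a" "0 < b" for a b
  proof (rule generator_inj)
    have pos: "0 < q (1/2) x y" if "0 < x" "0 < y" for x y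
      using is_meanD(1) is_mean[of "1/2"] that by simp
    show "0 < resultant (q (1/2)) (q (1/2)) (q (1/2)) a b" "0 < q (1/2) a b"
      unfolding resultant_def using that by (intro pos; simp)+
    show "\<psi> (resultant (q (1/2)) (q (1/2)) (q (1/2)) a b) = \<psi> (q (1/2) a b)"
      unfolding resultant_def using that pos by (simp add: half_eq field_simps)
  qed
  then show ?thesis
    by (simp add: stable_mean_def symmetric eq_pos_def)
qed

text \<open>At (1, 2) \<open>min\<close> and \<open>max\<close> give an endpoint, but the midpoint
  of the distinct values \<open>\<psi> 1\<close> and \<open>\<psi> 2\<close> is neither of
  them.\<close>

lemma nontrivial: "nontrivial_mean (q (1/2))"
proof -
  have "q (1/2) 1 2 \<noteq> 1" "q (1/2) 1 2 \<noteq> 2"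
    using half_eq[of 1 2] generator_inj[of 1 2] by auto
  moreover have "q (1/2) 1 2 = m 1 2" if "eq_pos (q (1/2)) m" for m
    using that[unfolded eq_pos_def, rule_format, of 1 2] by simp
  ultimately show ?thesis
    using is_mean[of "1/2"] by (fastforce simp: nontrivial_mean_def)
qed

section \<open>Fixed points of refinement\<close>

lemma fixed_point_iff:
  assumes "is_mean p" "is_mean m" "0 < a" "0 < b"
  shows "m a b = q (1/2) (m (p a b) a) (m (p a b) b) \<longleftrightarrow>
    \<psi> (m a b) = refine p (\<lambda>a b. \<psi> (m a b)) a b"
proof -
  have pos: "0 < p a b" "0 < m a b" "0 < m (p a b) a" "0 < m (p a b) b"
    using assms is_meanD(1) by auto
  then have "0 < q (1/2) (m (p a b) a) (m (p a b) b)"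
    using is_meanD(1) is_mean[of "1/2"] by simp
  then show ?thesis
    using half_eq[OF pos(3,4)] generator_inj[OF pos(2)] by (auto simp: refine_def)
qed

text \<open>The bound applies to the pairs \<open>(c, a)\<close> and \<open>(c, b)\<close>. Their
  increments sum to the whole increment, so the factor 1/2 of the average survives.\<close>

lemma refine_contraction:
  assumes "is_mean p"
    and bound: "\<And>a b. 0 < a \<Longrightarrow> 0 < b \<Longrightarrow> \<bar>f a b - g a b\<bar> \<le> K * \<bar>\<psi> a - \<psi> b\<bar>"
    and "0 < a" "0 < b"
  shows "\<bar>refine p f a b - refine p g a b\<bar> \<le> K / 2 * \<bar>\<psi> a - \<psi> b\<bar>"
proof -
  define c where "c = p a b"
  have c: "0 < c" "c \<in> {min a b..max a b}"
    using is_meanD[OF assms(1,3,4)] by (simp_all add: c_def)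
  have "\<bar>refine p f a b - refine p g a b\<bar> \<le> (\<bar>f c a - g c a\<bar> + \<bar>f c b - g c b\<bar>) / 2"
    unfolding refine_def c_def[symmetric] by (auto simp: abs_if field_simps)
  also have "\<dots> \<le> K / 2 * (\<bar>\<psi> c - \<psi> a\<bar> + \<bar>\<psi> c - \<psi> b\<bar>)"
    using bound[OF c(1) assms(3)] bound[OF c(1) assms(4)] by (simp add: distrib_left)
  finally show ?thesis
    using increments_add[OF assms(3,4) c(2)] by simp
qed

lemma fixed_point_unique:
  assumes "is_mean p" and m: "is_mean m" "is_mean m'"
    and fp: "\<And>a b. 0 < a \<Longrightarrow> 0 < b \<Longrightarrow> m a b = q (1/2) (m (p a b) a) (m (p a b) b)"
      "\<And>a b. 0 < a \<Longrightarrow> 0 < b \<Longrightarrow> m' a b = q (1/2) (m' (p a b) a) (m' (p a b) b)"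
  shows "eq_pos m m'"
proof -
  have bound: "\<bar>\<psi> (m a b) - \<psi> (m' a b)\<bar> \<le> (1/2) ^ n * \<bar>\<psi> a - \<psi> b\<bar>" if "0 < a" "0 < b" for n a b
    using that
  proof (induction n arbitrary: a b)
    \<comment> \<open>Both means take values between \<open>a\<close> and \<open>b\<close>, so in
      the coordinate they differ by at most the whole increment.\<close>
    case 0
    then show ?case
      using generator_mem[of a b "m a b"] generator_mem[of a b "m' a b"] is_meanD(2)[OF m(1)]
        is_meanD(2)[OF m(2)] by (auto simp: min_def max_def split: if_splits)
  next
    case (Suc n)
    then show ?case
      using refine_contraction[OF assms(1), of "\<lambda>a b. \<psi> (m a b)" "\<lambda>a b. \<psi> (m' a b)" "(1/2) ^ n" a b]
        fixed_point_iff[OF assms(1) m(1)] fixed_point_iff[OF assms(1) m(2)] fp by simp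
  qed
  have "m a b = m' a b" if ab: "0 < a" "0 < b" for a b
  proof (rule generator_inj)
    show "0 < m a b" "0 < m' a b"
      using is_meanD(1) m ab by auto
    have "(\<lambda>n. (1/2) ^ n * \<bar>\<psi> a - \<psi> b\<bar>) \<longlonglongrightarrow> 0 * \<bar>\<psi> a - \<psi> b\<bar>"
      by (intro tendsto_intros LIMSEQ_power_zero) simp
    then have "\<bar>\<psi> (m a b) - \<psi> (m' a b)\<bar> \<le> 0"
      using bound[OF ab] by (intro LIMSEQ_le_const[where X = "\<lambda>n. (1/2) ^ n * \<bar>\<psi> a - \<psi> b\<bar>"]) auto
    then show "\<psi> (m a b) = \<psi> (m' a b)" by simp
  qed
  then show ?thesis by (simp add: eq_pos_def)
qed

text \<open>Iterated refinement converges pointwise to a fixed point in the coordinate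
  \<open>\<psi>\<close>, and \<open>\<chi>\<close> carries it back to a mean.\<close>

lemma fixed_point_exists:
  assumes "symmetric_mean p"
  shows "\<exists>m. symmetric_mean m \<and>
    (\<forall>a>0. \<forall>b>0. m a b = q (1/2) (m (p a b) a) (m (p a b) b))"
proof -
  have p: "is_mean p" and p_sym: "\<And>a b. 0 < a \<Longrightarrow> 0 < b \<Longrightarrow> p a b = p b a"
    using assms by (auto simp: symmetric_mean_def)
  \<comment> \<open>The starting function is symmetric and takes values between
    \<open>\<psi> a\<close> and \<open>\<psi> b\<close>; refinement preserves both
    properties.\<close>
  define F where "F k = (refine p ^^ k) (\<lambda>a b. (\<psi> a + \<psi> b) / 2)" for k
  have F_Suc: "F (Suc k) = refine p (F k)" for k
    by (simp add: F_def)
  have F_mem: "F k a b \<in> {min (\<psi> a) (\<psi> b)..max (\<psi> a) (\<psi> b)}" if "0 < a" "0 < b" for k a b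
    using that
  proof (induction k arbitrary: a b)
    case 0
    show ?case by (auto simp: F_def min_def max_def)
  next
    case (Suc k)
    note c = is_meanD[OF p Suc.prems]
    show ?case
      using Suc.IH[OF c(1) Suc.prems(1)] Suc.IH[OF c(1) Suc.prems(2)] generator_mem[OF Suc.prems c(2)]
      unfolding F_Suc refine_def by (auto simp: min_def max_def split: if_splits)
  qed
  \<comment> \<open>A case distinction replaces induction: as \<open>p\<close> is symmetric,
    swapping \<open>a\<close> and \<open>b\<close> merely permutes the two summands of a
    refinement.\<close>
  have F_sym: "F k a b = F k b a" if "0 < a" "0 < b" for k a b
    using that p_sym[OF that] by (cases k) (auto simp: F_Suc refine_def F_def)
  have F_diff: "\<bar>F (Suc k) a b - F k a b\<bar> \<le> (1/2) ^ k * \<bar>\<psi> a - \<psi> b\<bar>" if "0 < a" "0 < b" for k a b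
    using that
  proof (induction k arbitrary: a b)
    case 0
    then show ?case
      using F_mem[of a b 0] F_mem[of a b 1] by (auto simp: min_def max_def split: if_splits)
  next
    case (Suc k)
    then show ?case
      using refine_contraction[OF p, of "F (Suc k)" "F k" "(1/2) ^ k" a b] by (simp add: F_Suc)
  qed
  define L where "L a b = lim (\<lambda>k. F k a b)" for a b
  have F_lim: "(\<lambda>k. F k a b) \<longlonglongrightarrow> L a b" if "0 < a" "0 < b" for a b
  proof -
    \<comment> \<open>The contraction makes the consecutive differences geometrically small, and
      their partial sums telescope to \<open>F n a b - F 0 a b\<close>.\<close>
    have "summable (\<lambda>k. F (Suc k) a b - F k a b)"
    proof (rule summable_comparison_test')
      show "summable (\<lambda>k. (1/2) ^ k * \<bar>\<psi> a - \<psi> b\<bar>)"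
        by (intro summable_mult2 summable_geometric) simp
    qed (use F_diff that in simp)
    then have "convergent (\<lambda>n. F n a b - F 0 a b)"
      unfolding summable_iff_convergent sum_lessThan_telescope[of "\<lambda>k. F k a b"] .
    then have "convergent (\<lambda>n. F n a b)"
      using convergent_add[OF _ convergent_const, of "\<lambda>n. F n a b - F 0 a b" "F 0 a b"] by simp
    then show ?thesis
      by (simp add: L_def convergent_LIMSEQ_iff)
  qed
  have L_mem: "L a b \<in> {min (\<psi> a) (\<psi> b)..max (\<psi> a) (\<psi> b)}" if "0 < a" "0 < b" for a b
  proof -
    have "min (\<psi> a) (\<psi> b) \<le> L a b"
      using F_mem[OF that] by (intro LIMSEQ_le_const[OF F_lim[OF that]]) auto
    moreover have "L a b \<le> max (\<psi> a) (\<psi> b)"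
      using F_mem[OF that] by (intro LIMSEQ_le_const2[OF F_lim[OF that]]) auto
    ultimately show ?thesis by simp
  qed
  have L_fp: "L a b = refine p L a b" if ab: "0 < a" "0 < b" for a b
  proof (rule LIMSEQ_unique)
    show "(\<lambda>k. F (Suc k) a b) \<longlonglongrightarrow> L a b"
      using F_lim[OF ab] by (rule LIMSEQ_Suc)
    \<comment> \<open>Refinement at \<open>(a, b)\<close> reads only two values of its argument, so
      it commutes with pointwise limits.\<close>
    show "(\<lambda>k. F (Suc k) a b) \<longlonglongrightarrow> refine p L a b"
      unfolding F_Suc refine_def using is_meanD(1)[OF p ab] ab by (intro tendsto_intros F_lim) auto
  qed
  define m where "m a b = \<chi> (L a b)" for a b
  have m: "m a b \<in> {min a b..max a b}" "\<psi> (m a b) = L a b" "0 < m a b" if "0 < a" "0 < b" for a b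
    using inverse_mem[OF that L_mem[OF that]] by (simp_all add: m_def)
  have "L a b = L b a" if "0 < a" "0 < b" for a b
    using F_sym[OF that] by (simp add: L_def)
  then have sym: "symmetric_mean m"
    using m by (auto simp: symmetric_mean_def is_mean_def m_def)
  moreover have "m a b = q (1/2) (m (p a b) a) (m (p a b) b)" if ab: "0 < a" "0 < b" for a b
    using fixed_point_iff[OF p _ ab, of m] sym ab m L_fp[OF ab] is_meanD(1)[OF p ab]
    by (simp add: symmetric_mean_def refine_def)
  ultimately show ?thesis by blast
qed

end

section \<open>Generators of the three standard weighted means\<close>

lemma quasi_arithmetic_arith: "quasi_arithmetic wt_arith (\<lambda>x. x) (\<lambda>x. x)"
  by unfold_locales (simp_all add: wt_arith_def)

lemma quasi_arithmetic_geom: "quasi_arithmetic wt_geom ln exp"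
proof
  fix a b :: real assume ab: "0 < a" "0 < b"
  show "wt_geom v a b = exp ((1 - v) * ln a + v * ln b)" for v
    using ab by (simp add: wt_geom_def powr_def exp_add)
  have minmax: "min (ln a) (ln b) = ln (min a b)" "max (ln a) (ln b) = ln (max a b)"
    using ab by (auto simp: min_def max_def)
  have pos: "0 < min a b" "0 < max a b" using ab by auto
  show "ln ` {min a b..max a b} = {min (ln a) (ln b)..max (ln a) (ln b)}"
    unfolding minmax
  proof (intro equalityI subsetI)
    fix t assume t: "t \<in> {ln (min a b)..ln (max a b)}"
    then have "exp t \<in> {min a b..max a b}"
      using pos by (metis atLeastAtMost_iff exp_le_cancel_iff exp_ln)
    then show "t \<in> ln ` {min a b..max a b}"
      by (intro image_eqI[of _ _ "exp t"]) simp_all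
  next
    fix t assume "t \<in> ln ` {min a b..max a b}"
    then obtain c where c: "t = ln c" "min a b \<le> c" "c \<le> max a b" by auto
    with pos have "0 < c" by linarith
    with c pos show "t \<in> {ln (min a b)..ln (max a b)}" by simp
  qed
qed simp

lemma quasi_arithmetic_harm: "quasi_arithmetic wt_harm inverse inverse"
proof
  fix a b :: real assume ab: "0 < a" "0 < b"
  show "wt_harm v a b = inverse ((1 - v) * inverse a + v * inverse b)" for v
    by (simp add: wt_harm_def)
  \<comment> \<open>Inversion reverses the order, so \<open>min\<close> and \<open>max\<close> trade
    places.\<close>
  have minmax: "min (inverse a) (inverse b) = inverse (max a b)"
      "max (inverse a) (inverse b) = inverse (min a b)"
    using ab by (auto simp: min_def max_def)
  have pos: "0 < min a b" "0 < max a b" using ab by auto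
  \<comment> \<open>As inversion is an involution, this serves both inclusions, applied to the
    interval of reciprocals for one and to the original interval for the other.\<close>
  have flip: "inverse t \<in> {inverse d..inverse c}" if "0 < c" "t \<in> {c..d}" for c d t :: real
    using that by (auto intro!: le_imp_inverse_le)
  show "inverse ` {min a b..max a b} = {min (inverse a) (inverse b)..max (inverse a) (inverse b)}"
    unfolding minmax
  proof (intro equalityI subsetI)
    fix t assume "t \<in> {inverse (max a b)..inverse (min a b)}"
    then have "inverse t \<in> {min a b..max a b}"
      using flip[of "inverse (max a b)" t "inverse (min a b)"] pos by simp
    then show "t \<in> inverse ` {min a b..max a b}"
      by (intro image_eqI[of _ _ "inverse t"]) simp_all
  next
    fix t assume "t \<in> inverse ` {min a b..max a b}"
    then show "t \<in> {inverse (max a b)..inverse (min a b)}"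
      using flip pos by blast
  qed
qed simp

lemma quasi_arithmetic_standard:
  assumes "q \<in> {wt_arith, wt_geom, wt_harm}"
  obtains \<psi> \<chi> where "quasi_arithmetic q \<psi> \<chi>"
  using assms quasi_arithmetic_arith quasi_arithmetic_geom quasi_arithmetic_harm by auto

theorem corollary3p4:
  fixes p q :: "real \<Rightarrow> real \<Rightarrow> real \<Rightarrow> real"
  assumes "p \<in> {wt_arith, wt_geom, wt_harm}"
    and "q \<in> {wt_arith, wt_geom, wt_harm}"
  shows "\<exists>M. weighted_mean M \<and> solves_mean_eq p q M \<and>
      (\<forall>M'. weighted_mean M' \<and> solves_mean_eq p q M' \<longrightarrow> (\<forall>v\<in>{0..1}. eq_pos (M' v) (M v))) \<and>
      stabilizable_by (q (1/2)) (p (1/2)) (M (1/2)) \<and>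
      (\<forall>m. stabilizable_by (q (1/2)) (p (1/2)) m \<longrightarrow> eq_pos m (M (1/2)))"
proof -
  obtain \<phi> \<phi>' where "quasi_arithmetic p \<phi> \<phi>'"
    using assms(1) by (rule quasi_arithmetic_standard)
  then interpret p: quasi_arithmetic p \<phi> \<phi>' .
  obtain \<psi> \<chi> where "quasi_arithmetic q \<psi> \<chi>"
    using assms(2) by (rule quasi_arithmetic_standard)
  then interpret q: quasi_arithmetic q \<psi> \<chi> .
  obtain m where m: "symmetric_mean m"
    and fp: "\<And>a b. 0 < a \<Longrightarrow> 0 < b \<Longrightarrow> m a b = q (1/2) (m (p (1/2) a b) a) (m (p (1/2) a b) b)"
    using q.fixed_point_exists[OF p.symmetric] by blast
  have p_mean: "is_mean (p (1/2))"
    using p.is_mean by simp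
  have m_mean: "is_mean m"
    using m by (simp add: symmetric_mean_def)
  \<comment> \<open>The equation read as a definition, with the fixed point \<open>m\<close> in
    place of \<open>M (1/2)\<close> to avoid circularity; at \<open>v = 1/2\<close> it returns
    \<open>m\<close>.\<close>
  define M where "M v a b = q v (m (p v a b) a) (m (p v a b) b)" for v a b
  have M_half: "M (1/2) a b = m a b" if "0 < a" "0 < b" for a b
    using fp[OF that] by (simp add: M_def)
  have M_mean: "is_mean (M v)" if v: "v \<in> {0..1}" for v
    unfolding is_mean_def
  proof (intro allI impI)
    fix a b :: real assume ab: "0 < a" "0 < b"
    define c where "c = p v a b"
    have c: "0 < c" "c \<in> {min a b..max a b}"
      using is_meanD[OF p.is_mean[OF v] ab] by (simp_all add: c_def)
    note ca = is_meanD[OF m_mean c(1) ab(1)] and cb = is_meanD[OF m_mean c(1) ab(2)]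
    show "0 < M v a b \<and> min a b \<le> M v a b \<and> M v a b \<le> max a b"
      unfolding M_def c_def[symmetric]
      using is_meanD[OF q.is_mean[OF v] ca(1) cb(1)] ca(2) cb(2) c(2) by auto
  qed
  have M_sol: "solves_mean_eq p q M"
    unfolding solves_mean_eq_def
    using M_half is_meanD(1)[OF p.is_mean] by (simp add: M_def)
  \<comment> \<open>The inner point is the same on both sides, since
    \<open>p (1 - v) b a = p v a b\<close>; the flip of \<open>q\<close> then swaps the two outer
    arguments.\<close>
  have M_flip: "M v a b = M (1 - v) b a" if "0 < a" "0 < b" "v \<in> {0..1}" for v a b
    using that is_meanD(1)[OF p.is_mean, of v a b]
    by (simp add: M_def p.flip q.flip is_meanD(1)[OF m_mean])
  have M_sym: "symmetric_mean (M (1/2))"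
    using M_mean M_flip[of _ _ "1/2"] by (simp add: symmetric_mean_def)
  have M_weighted: "weighted_mean M"
    unfolding weighted_mean_def using M_mean M_sym M_flip by blast
  \<comment> \<open>Shared by both uniqueness claims: for the weighted mean and for the stabilizable
    mean.\<close>
  have unique: "eq_pos m' (M (1/2))"
    if "is_mean m'" "\<And>a b. 0 < a \<Longrightarrow> 0 < b \<Longrightarrow>
      m' a b = q (1/2) (m' (p (1/2) a b) a) (m' (p (1/2) a b) b)" for m'
    using q.fixed_point_unique[OF p_mean that(1) m_mean that(2) fp] M_half
    by (simp add: eq_pos_def)
  have M_unique: "eq_pos (M' v) (M v)"
    if M': "weighted_mean M'" "solves_mean_eq p q M'" and v: "v \<in> {0..1}" for M' v
  proof -
    note sol' = M'(2)[unfolded solves_mean_eq_def, rule_format]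
      and sol = M_sol[unfolded solves_mean_eq_def, rule_format]
    \<comment> \<open>At \<open>v = 1/2\<close> the equation involves \<open>M' (1/2)\<close> alone;
      once that is known, the equation determines every other weight.\<close>
    have "eq_pos (M' (1/2)) (M (1/2))"
      using M'(1) by (intro unique sol') (simp_all add: weighted_mean_def)
    then show ?thesis
      using sol'[OF v] sol[OF v] is_meanD(1)[OF p.is_mean[OF v]] by (simp add: eq_pos_def)
  qed
  \<comment> \<open>The resultant has \<open>m' a (p (1/2) a b)\<close> in the first slot, with the
    arguments in the opposite order to the equation; symmetry of \<open>m'\<close> reconciles
    them.\<close>
  have resultant_eq: "resultant (q (1/2)) m' (p (1/2)) a b =
      q (1/2) (m' (p (1/2) a b) a) (m' (p (1/2) a b) b)"
    if "symmetric_mean m'" "0 < a" "0 < b" for m' a b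
    using that is_meanD(1)[OF p_mean] by (simp add: resultant_def symmetric_mean_def)
  have M_stab: "stabilizable_by (q (1/2)) (p (1/2)) (M (1/2))"
    unfolding stabilizable_by_def
    using M_sym q.stable q.nontrivial p.stable p.nontrivial M_sol resultant_eq[OF M_sym]
    by (simp add: eq_pos_def solves_mean_eq_def)
  have "eq_pos m' (M (1/2))" if stab: "stabilizable_by (q (1/2)) (p (1/2)) m'" for m'
  proof (rule unique)
    have m': "symmetric_mean m'" and res: "eq_pos (resultant (q (1/2)) m' (p (1/2))) m'"
      using stab by (simp_all add: stabilizable_by_def)
    show "is_mean m'"
      using m' by (simp add: symmetric_mean_def)
    show "m' a b = q (1/2) (m' (p (1/2) a b) a) (m' (p (1/2) a b) b)" if "0 < a" "0 < b" for a b
      using res resultant_eq[OF m' that] that by (simp add: eq_pos_def)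
  qed
  with M_weighted M_sol M_unique M_stab show ?thesis by blast
qed

end
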